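(* Let $L>\pi$. For $c\in\left(1+\frac{\pi}{L-\pi},+\infty\right)$ let $$\phi_c(\xi)=\frac{2c\pi}{L}\left(\frac{\sinh(\eta)}{\cosh(\eta)-\cos\left(\frac{\pi\xi}{L}\right)}\right),\qquad \eta=\eta(c)=\tanh^{-1}\left(\frac{c\pi}{(c-1)L}\right).$$ Then the curve $$c\in\left(1+\tfrac{\pi}{L-\pi},+\infty\right)\longmapsto\phi_c\in H^{\frac12}_{per}([-L,L])$$ is of class $C^1$. Furthermore, since $c>1+\frac{\pi}{L-\pi}$, we have $\phi_c>0$.
   Context: $H^{\frac12}_{per}([-L,L])$ is the Sobolev space of $2L$-periodic distributions with norm $\|f\|^2_{H^{1/2}_{per}}=2L\sum_{k\in\mathbb{Z}}(1+|k|^2)^{1/2}|\widehat f(k)|^2$, where $\widehat f(k)=\frac1{2L}\int_{-L}^Lf(x)e^{-ik\pi x/L}dx$. *)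

theory Defs
  imports "HOL-Analysis.Analysis"
begin

definition nth_vderiv :: "nat \<Rightarrow> (real \<Rightarrow> complex) \<Rightarrow> real \<Rightarrow> complex" where
  "nth_vderiv n u = ((\<lambda>g x. vector_derivative g (at x)) ^^ n) u"

text \<open>Test functions: the smooth complex-valued functions on the line of period \<open>2L\<close>.\<close>

definition per_test :: "real \<Rightarrow> (real \<Rightarrow> complex) set" where
  "per_test L = {u. (\<forall>n. nth_vderiv n u differentiable_on UNIV) \<and> (\<forall>x. u (x + 2 * L) = u x)}"

text \<open>Distributions of period \<open>2L\<close>: the complex-linear functionals on the test functions that are
  continuous for the seminorms \<open>u \<mapsto> sup \<bar>u^(j)\<bar>\<close>. By periodicity the supremum may be taken
  over one period. A functional is a total function here; it is set to \<open>0\<close> off the test functions,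
  so that equality of distributions is equality of functions.\<close>

definition per_distr :: "real \<Rightarrow> ((real \<Rightarrow> complex) \<Rightarrow> complex) set" where
  "per_distr L = {T.
     (\<forall>u\<in>per_test L. \<forall>v\<in>per_test L. T (\<lambda>x. u x + v x) = T u + T v) \<and>
     (\<forall>u\<in>per_test L. \<forall>a. T (\<lambda>x. a * u x) = a * T u) \<and>
     (\<exists>C N. \<forall>u\<in>per_test L.
        norm (T u) \<le> C * (\<Sum>j\<le>N. SUP x\<in>{-L..L}. norm (nth_vderiv j u x))) \<and>
     (\<forall>u. u \<notin> per_test L \<longrightarrow> T u = 0)}"

definition distr_of_fun :: "real \<Rightarrow> (real \<Rightarrow> complex) \<Rightarrow> (real \<Rightarrow> complex) \<Rightarrow> complex" where
  "distr_of_fun L f u = (if u \<in> per_test L then (LBINT x:{-L..L}. f x * u x) else 0)"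

definition per_exp :: "real \<Rightarrow> int \<Rightarrow> real \<Rightarrow> complex" where
  "per_exp L k x = exp (- \<i> * of_int k * of_real pi * of_real x / of_real L)"

text \<open>For a distribution the integral in the formula for the Fourier coefficients is the pairing
  with the exponential; see \<open>fourier_coeff_distr_of_fun\<close> below.\<close>

definition fourier_coeff :: "real \<Rightarrow> ((real \<Rightarrow> complex) \<Rightarrow> complex) \<Rightarrow> int \<Rightarrow> complex" where
  "fourier_coeff L T k = 1 / of_real (2 * L) * T (per_exp L k)"

definition H_half_per :: "real \<Rightarrow> ((real \<Rightarrow> complex) \<Rightarrow> complex) set" where
  "H_half_per L = {T \<in> per_distr L.
     (\<lambda>k. sqrt (1 + (real_of_int k)\<^sup>2) * (norm (fourier_coeff L T k))\<^sup>2) summable_on UNIV}"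

definition H_half_norm :: "real \<Rightarrow> ((real \<Rightarrow> complex) \<Rightarrow> complex) \<Rightarrow> real" where
  "H_half_norm L T =
     sqrt (2 * L * (\<Sum>\<^sub>\<infinity>k. sqrt (1 + (real_of_int k)\<^sup>2) * (norm (fourier_coeff L T k))\<^sup>2))"

text \<open>Class \<open>C\<^sup>1\<close> for a curve with values in \<open>H_half_per L\<close>, spelled out for the norm
  \<open>H_half_norm L\<close>: the space depends on the real number \<open>L\<close>, hence it is not a type and
  \<open>C1_differentiable_on\<close> does not apply. \<open>D\<close> is the derivative curve.\<close>

definition H_half_C1_on ::
  "real \<Rightarrow> real set \<Rightarrow> (real \<Rightarrow> (real \<Rightarrow> complex) \<Rightarrow> complex) \<Rightarrow> bool" where
  "H_half_C1_on L S \<gamma> \<longleftrightarrow>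
     (\<forall>c\<in>S. \<gamma> c \<in> H_half_per L) \<and>
     (\<exists>D. (\<forall>c\<in>S. D c \<in> H_half_per L) \<and>
          (\<forall>c\<in>S. ((\<lambda>d. H_half_norm L (\<lambda>u. (\<gamma> d u - \<gamma> c u) / of_real (d - c) - D c u))
                    \<longlongrightarrow> 0) (at c within S)) \<and>
          (\<forall>c\<in>S. ((\<lambda>d. H_half_norm L (\<lambda>u. D d u - D c u)) \<longlongrightarrow> 0) (at c within S)))"

definition eta :: "real \<Rightarrow> real \<Rightarrow> real" where
  "eta L c = artanh (c * pi / ((c - 1) * L))"

definition phi :: "real \<Rightarrow> real \<Rightarrow> real \<Rightarrow> real" where
  "phi L c \<xi> = 2 * c * pi / L * (sinh (eta L c) / (cosh (eta L c) - cos (pi * \<xi> / L)))"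

lemma nth_vderiv_per_exp:
  "nth_vderiv n (per_exp L k) =
     (\<lambda>x. (- \<i> * of_int k * of_real pi / of_real L) ^ n * per_exp L k x)"
proof (induction n)
  case 0
  show ?case by (simp add: nth_vderiv_def)
next
  case (Suc n)
  define w where "w = - \<i> * of_int k * of_real pi / of_real L"
  have e: "per_exp L k = (\<lambda>x. exp (x *\<^sub>R w))"
    by (rule ext) (simp add: per_exp_def w_def scaleR_conv_of_real mult_ac)
  have "((\<lambda>x. w ^ n * exp (x *\<^sub>R w)) has_vector_derivative w ^ n * (exp (x *\<^sub>R w) * w)) (at x)" for x
    by (intro has_vector_derivative_mult_right exp_scaleR_has_vector_derivative_right)
  then have "vector_derivative (\<lambda>x. w ^ n * exp (x *\<^sub>R w)) (at x) = w ^ Suc n * exp (x *\<^sub>R w)" for x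
    by (simp add: vector_derivative_at mult_ac)
  with Suc show ?case
    unfolding w_def[symmetric] by (simp add: nth_vderiv_def e)
qed

lemma per_exp_in_per_test:
  assumes "L \<noteq> 0"
  shows "per_exp L k \<in> per_test L"
proof -
  define w where "w = - \<i> * of_int k * of_real pi / of_real L"
  have e: "per_exp L k = (\<lambda>x. exp (x *\<^sub>R w))"
    by (rule ext) (simp add: per_exp_def w_def scaleR_conv_of_real mult_ac)
  have "((\<lambda>x. a * exp (x *\<^sub>R w)) has_vector_derivative a * (exp (x *\<^sub>R w) * w)) (at x)" for a x
    by (intro has_vector_derivative_mult_right exp_scaleR_has_vector_derivative_right)
  then have "(\<lambda>x. a * per_exp L k x) differentiable_on UNIV" for a
    unfolding e differentiable_on_def by (blast intro: differentiableI_vector)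
  moreover have "per_exp L k (x + 2 * L) = per_exp L k x" for x
  proof -
    have "- \<i> * of_int k * of_real pi * of_real (x + 2 * L) / of_real L =
          - \<i> * of_int k * of_real pi * of_real x / of_real L + 2 * of_int (- k) * of_real pi * \<i>"
      using assms by (simp add: field_simps)
    moreover have "exp (2 * of_int (- k) * of_real pi * \<i>) = 1"
      using exp_integer_2pi[of "of_int (- k)"] by simp
    ultimately show ?thesis
      unfolding per_exp_def by (simp only: exp_add mult_1_right)
  qed
  ultimately show ?thesis
    by (simp add: per_test_def nth_vderiv_per_exp)
qed

lemma fourier_coeff_distr_of_fun:
  assumes "L \<noteq> 0"
  shows "fourier_coeff L (distr_of_fun L f) k =
    1 / of_real (2 * L) *
      (LBINT x:{-L..L}. f x * exp (- \<i> * of_int k * of_real pi * of_real x / of_real L))"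
  using per_exp_in_per_test[OF assms] by (simp add: fourier_coeff_def distr_of_fun_def per_exp_def)

end

(* With q = exp (- eta), phi_c is 2 c pi / L times the Poisson kernel, hence a cosine series with
   Fourier coefficients a_k(c) = (2 c pi / L) q(c)^|k|, where 0 < q < 1. Locally uniformly in c,
   these and their derivatives in c decay geometrically in |k|. By the mean value theorem the difference
   quotients of a_k obey the same bound as a_k', so dominated convergence for series (Tannery's
   theorem) turns the C^1 dependence of each coefficient into convergence in H^{1/2}. *)

theory Submission
  imports Defs
begin

text \<open>No derivative of \<open>phi\<close> in c is taken pointwise. The derivative curve is
  built from Fourier data: it is the cosine series whose coefficients are the derivatives of the
  coefficients, so that both limits in \<open>H_half_C1_on\<close> become statements about real
  sequences indexed by |k|. The quantity to control is
  \<open>(1 + real n) * \<bar>b n\<bar>\<close>. A summable bound on it makes the cosine series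
  converge absolutely, hence to a continuous function that defines a distribution, and also makes
  the H^{1/2} norm finite. This asks for more decay than H^{1/2} does, which is harmless because
  geometric decay absorbs every power of n. The condition on c enters as c pi < (c - 1) L, which
  puts the argument of \<open>artanh\<close> below 1 and thereby q below 1.\<close>

section \<open>Exponentials and cosines over one period\<close>

lemma norm_per_exp [simp]: "norm (per_exp L k x) = 1"
proof -
  have "per_exp L k x = exp (\<i> * of_real (- of_int k * pi * x / L))"
    by (simp add: per_exp_def mult.assoc)
  then show ?thesis
    by (simp only: norm_exp_i_times)
qed

lemma continuous_on_per_exp: "continuous_on A (per_exp L k)"
  unfolding per_exp_def by (cases "L = 0") (auto intro!: continuous_intros)

lemma per_exp_has_integral:
  assumes "L > 0"
  shows "(per_exp L k has_integral (if k = 0 then of_real (2 * L) else 0)) {-L..L}"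
proof (cases "k = 0")
  case True
  have "((\<lambda>x. 1::complex) has_integral of_real (2 * L)) {-L..L}"
    using has_integral_const_real[of "1::complex" "-L" L] assms by (simp add: scaleR_conv_of_real)
  with True show ?thesis
    by (simp add: per_exp_def[abs_def])
next
  case False
  define w where "w = - \<i> * of_int k * of_real pi / of_real L"
  have w: "w \<noteq> 0"
    using False assms by (simp add: w_def)
  have e: "per_exp L k = (\<lambda>x. exp (x *\<^sub>R w))"
    by (rule ext) (simp add: per_exp_def w_def scaleR_conv_of_real mult_ac)
  have "((\<lambda>x. exp (x *\<^sub>R w) / w) has_vector_derivative exp (x *\<^sub>R w)) (at x within {-L..L})" for x
    using has_vector_derivative_divide[OF exp_scaleR_has_vector_derivative_right[of w x "{-L..L}"], of w] w
    by simp
  then have "((\<lambda>x. exp (x *\<^sub>R w)) has_integral exp (L *\<^sub>R w) / w - exp ((-L) *\<^sub>R w) / w) {-L..L}"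
    by (intro fundamental_theorem_of_calculus) (use assms in auto)
  \<comment> \<open>Periodicity read at \<open>-L\<close>: the boundary terms of the antiderivative
    cancel.\<close>
  moreover have "exp (L *\<^sub>R w) = exp ((-L) *\<^sub>R w)"
    using per_exp_in_per_test[of L k] assms unfolding e per_test_def
    by (auto dest!: spec[of _ "-L"])
  ultimately show ?thesis
    using False by (simp add: e)
qed

text \<open>The cosine is half the sum of the exponentials of frequencies n and -n, and
  orthogonality leaves only |k| = n. For n = 0 the two exponentials coincide and both contribute,
  hence \<open>2 * L\<close> in place of \<open>L\<close>.\<close>

lemma cos_per_exp_has_integral:
  assumes "L > 0"
  shows "((\<lambda>x. of_real (cos (real n * pi * x / L)) * per_exp L k x) has_integral
           (if n = nat \<bar>k\<bar> then of_real (if n = 0 then 2 * L else L) else 0)) {-L..L}"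
proof -
  have mult: "per_exp L i x * per_exp L j x = per_exp L (i + j) x" for i j x
    by (simp add: per_exp_def exp_add[symmetric] add_divide_distrib diff_divide_distrib ring_distribs)
  have cos: "of_real (cos (real n * pi * x / L)) = (per_exp L (- int n) x + per_exp L (int n) x) / 2" for x
    by (simp add: per_exp_def cos_of_real[symmetric] cos_exp_eq mult_ac)
  have "((\<lambda>x. (per_exp L (k - int n) x + per_exp L (k + int n) x) / 2) has_integral
          ((if k - int n = 0 then of_real (2 * L) else 0) +
           (if k + int n = 0 then of_real (2 * L) else 0)) / 2) {-L..L}"
    by (intro has_integral_divide has_integral_add per_exp_has_integral assms)
  moreover have "(per_exp L (k - int n) x + per_exp L (k + int n) x) / 2 =
      of_real (cos (real n * pi * x / L)) * per_exp L k x" for x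
    using mult[of "- int n" x k] mult[of "int n" x k]
    by (simp only: cos) (simp add: field_simps)
  moreover have "((if k - int n = 0 then of_real (2 * L) else 0) +
           (if k + int n = 0 then of_real (2 * L) else 0)) / 2 =
      (if n = nat \<bar>k\<bar> then of_real (if n = 0 then 2 * L else L) else (0::complex))"
    by auto
  ultimately show ?thesis
    by simp
qed

section \<open>Cosine series and their Fourier coefficients\<close>

text \<open>This is the two-sided Fourier series with coefficient \<open>b \<bar>k\<bar>\<close> at
  each integer k, the terms k and -k being merged. The factor 2 for n > 0 counts that pair.\<close>

definition cos_series :: "real \<Rightarrow> (nat \<Rightarrow> real) \<Rightarrow> real \<Rightarrow> real" where
  "cos_series L b x = (\<Sum>n. (if n = 0 then 1 else 2) * b n * cos (real n * pi * x / L))"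

lemma cos_series_uniform_limit:
  assumes "summable (\<lambda>n. \<bar>b n\<bar>)"
  shows "uniform_limit A (\<lambda>N x. \<Sum>n<N. (if n = 0 then 1 else 2) * b n * cos (real n * pi * x / L))
           (cos_series L b) sequentially"
  unfolding cos_series_def[abs_def]
proof (rule Weierstrass_m_test)
  show "norm ((if n = 0 then 1 else 2) * b n * cos (real n * pi * x / L)) \<le> 2 * \<bar>b n\<bar>" for n x
  proof -
    have "\<bar>b n\<bar> * \<bar>cos (real n * pi * x / L)\<bar> \<le> \<bar>b n\<bar> * 1"
      by (intro mult_left_mono) auto
    then show ?thesis
      by (auto simp: abs_mult)
  qed
  show "summable (\<lambda>n. 2 * \<bar>b n\<bar>)"
    by (intro summable_mult assms)
qed

lemma continuous_on_cos_series:
  assumes "summable (\<lambda>n. \<bar>b n\<bar>)"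
  shows "continuous_on A (cos_series L b)"
proof (rule uniform_limit_theorem[OF _ cos_series_uniform_limit[OF assms]])
  show "\<forall>\<^sub>F N in sequentially. continuous_on A
      (\<lambda>x. \<Sum>n<N. (if n = 0 then 1 else 2) * b n * cos (real n * pi * x / L))"
    by (cases "L = 0") (auto intro!: always_eventually continuous_intros)
qed simp

text \<open>The factor \<open>per_exp L k\<close> has modulus 1, so the product with the partial
  sums still converges uniformly and may be integrated termwise. The weights 1 and 2 compensate the
  integrals \<open>2 * L\<close> and \<open>L\<close>, so the surviving term has the same form for
  every k.\<close>

lemma fourier_coeff_cos_series:
  assumes "L > 0" and b: "summable (\<lambda>n. \<bar>b n\<bar>)"
  shows "fourier_coeff L (distr_of_fun L (\<lambda>x. of_real (cos_series L b x))) k = of_real (b (nat \<bar>k\<bar>))"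
proof -
  define m where "m n = (if n = 0 then 1 else 2 :: real)" for n :: nat
  define F where "F N x = (\<Sum>n<N. of_real (m n * b n) * (of_real (cos (real n * pi * x / L)) * per_exp L k x))"
    for N x
  let ?g = "\<lambda>x. of_real (cos_series L b x) * per_exp L k x"
  have Feq: "F N x = of_real (\<Sum>n<N. m n * b n * cos (real n * pi * x / L)) * per_exp L k x" for N x
    by (simp add: F_def sum_distrib_right mult.assoc)
  have lim: "uniform_limit {-L..L} F ?g sequentially"
  proof (rule uniform_limitI)
    fix e :: real assume "e > 0"
    from uniform_limitD[OF cos_series_uniform_limit[OF b] this, of "{-L..L}" L]
    show "\<forall>\<^sub>F N in sequentially. \<forall>x\<in>{-L..L}. dist (F N x) (?g x) < e"
    proof (rule eventually_mono, intro ballI)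
      fix N x
      assume *: "\<forall>x\<in>{-L..L}. dist (\<Sum>n<N. (if n = 0 then 1 else 2) * b n * cos (real n * pi * x / L))
        (cos_series L b x) < e" and x: "x \<in> {-L..L}"
      have "dist (F N x) (?g x) = dist (\<Sum>n<N. m n * b n * cos (real n * pi * x / L)) (cos_series L b x)"
        unfolding Feq dist_norm left_diff_distrib[symmetric] norm_mult of_real_diff[symmetric]
          norm_of_real norm_per_exp
        by simp
      also have "\<dots> < e"
        using * x by (simp add: m_def)
      finally show "dist (F N x) (?g x) < e" .
    qed
  qed
  have F: "(F N has_integral (\<Sum>n<N. of_real (m n * b n) *
      (if n = nat \<bar>k\<bar> then of_real (if n = 0 then 2 * L else L) else 0))) {-L..L}" for N
    unfolding F_def[abs_def]
    by (intro has_integral_sum has_integral_mult_right cos_per_exp_has_integral assms) auto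
  have cont: "continuous_on {-L..L} (F N)" for N
    unfolding F_def[abs_def] using assms
    by (intro continuous_intros continuous_on_per_exp) auto
  obtain I J where I: "\<And>N. (F N has_integral I N) {-L..L}" and J: "(?g has_integral J) {-L..L}"
    and IJ: "I \<longlonglongrightarrow> J"
    using uniform_limit_integral[OF lim cont] by auto
  \<comment> \<open>Once the partial sum includes the index |k|, its integral no longer changes, so
    the limit is read off an eventually constant sequence.\<close>
  have "I N = of_real (2 * L * b (nat \<bar>k\<bar>))" if "N > nat \<bar>k\<bar>" for N
  proof -
    have "I N = (\<Sum>n<N. if n = nat \<bar>k\<bar> then of_real (m n * b n * (if n = 0 then 2 * L else L)) else 0)"
      unfolding has_integral_unique[OF I F] by (intro sum.cong) auto
    also have "\<dots> = of_real (2 * L * b (nat \<bar>k\<bar>))"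
      using that by (simp add: sum.delta' m_def)
    finally show ?thesis .
  qed
  then have "\<forall>\<^sub>F N in sequentially. I N = of_real (2 * L * b (nat \<bar>k\<bar>))"
    unfolding eventually_at_top_dense by blast
  then have "I \<longlonglongrightarrow> of_real (2 * L * b (nat \<bar>k\<bar>))"
    by (rule tendsto_eventually)
  with IJ have Jeq: "J = of_real (2 * L * b (nat \<bar>k\<bar>))"
    using LIMSEQ_unique by blast
  have "set_integrable lborel {-L..L} ?g"
    by (intro borel_integrable_atLeastAtMost' continuous_intros continuous_on_per_exp
        continuous_on_cos_series b)
  from set_borel_integral_eq_integral(2)[OF this] J
  have "(LBINT x:{-L..L}. ?g x) = J"
    by (simp add: integral_unique)
  then show ?thesis
    using per_exp_in_per_test[of L k] assms(1) by (simp add: fourier_coeff_def distr_of_fun_def Jeq)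
qed

section \<open>Continuous functions as periodic distributions\<close>

text \<open>The seminorm of order 0 suffices: the pairing is at most the integral of |f| times the
  supremum of |u|.\<close>

lemma distr_of_fun_in_per_distr:
  assumes f: "continuous_on {-L..L} f"
  shows "distr_of_fun L f \<in> per_distr L"
proof -
  have cont: "continuous_on A u" if "u \<in> per_test L" for u A
  proof -
    have "nth_vderiv 0 u differentiable_on UNIV"
      using that unfolding per_test_def by blast
    then show ?thesis
      by (auto simp: nth_vderiv_def intro: differentiable_imp_continuous_on continuous_on_subset)
  qed
  have int: "set_integrable lborel {-L..L} (\<lambda>x. f x * u x)" if "u \<in> per_test L" for u
    by (intro borel_integrable_atLeastAtMost' continuous_intros f cont that)
  have vderiv_has: "(g has_vector_derivative vector_derivative g (at x)) (at x)"
    if "g differentiable_on UNIV" for g :: "real \<Rightarrow> complex" and x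
    using that by (simp add: differentiable_on_def vector_derivative_works[symmetric])
  have nth_add: "nth_vderiv n (\<lambda>x. u x + v x) = (\<lambda>x. nth_vderiv n u x + nth_vderiv n v x)"
    if "u \<in> per_test L" "v \<in> per_test L" for n u v
  proof (induction n)
    case (Suc n)
    have "vector_derivative (\<lambda>x. nth_vderiv n u x + nth_vderiv n v x) (at x) =
        vector_derivative (nth_vderiv n u) (at x) + vector_derivative (nth_vderiv n v) (at x)" for x
      using that by (intro vector_derivative_at has_vector_derivative_add vderiv_has)
        (auto simp: per_test_def)
    with Suc show ?case
      by (simp add: nth_vderiv_def)
  qed (simp add: nth_vderiv_def)
  have nth_mult: "nth_vderiv n (\<lambda>x. a * u x) = (\<lambda>x. a * nth_vderiv n u x)"
    if "u \<in> per_test L" for n u a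
  proof (induction n)
    case (Suc n)
    have "vector_derivative (\<lambda>x. a * nth_vderiv n u x) (at x) =
        a * vector_derivative (nth_vderiv n u) (at x)" for x
      using that by (intro vector_derivative_at has_vector_derivative_mult_right vderiv_has)
        (auto simp: per_test_def)
    with Suc show ?case
      by (simp add: nth_vderiv_def)
  qed (simp add: nth_vderiv_def)
  \<comment> \<open>Since \<open>distr_of_fun\<close> is 0 off the test functions, its linearity
    requires that sums and multiples of test functions be test functions; this is why the iterated
    derivatives were shown to be linear.\<close>
  have add_closed: "(\<lambda>x. u x + v x) \<in> per_test L" if "u \<in> per_test L" "v \<in> per_test L" for u v
    using that by (auto simp: per_test_def nth_add[OF that] intro!: differentiable_on_add)
  have mult_closed: "(\<lambda>x. a * u x) \<in> per_test L" if "u \<in> per_test L" for u a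
    using that by (auto simp: per_test_def nth_mult[OF that] intro!: differentiable_on_mult)
  have bound: "norm (distr_of_fun L f u) \<le>
      (LBINT x:{-L..L}. norm (f x)) * (\<Sum>j\<le>0. SUP x\<in>{-L..L}. norm (nth_vderiv j u x))"
    if u: "u \<in> per_test L" for u
  proof -
    let ?s = "SUP x\<in>{-L..L}. norm (u x)"
    have "compact ((\<lambda>x. norm (u x)) ` {-L..L})"
      by (intro compact_continuous_image continuous_intros cont u) auto
    then have bdd: "bdd_above ((\<lambda>x. norm (u x)) ` {-L..L})"
      by (intro bounded_imp_bdd_above compact_imp_bounded)
    have s: "norm (u x) \<le> ?s" if "x \<in> {-L..L}" for x
      by (intro cSUP_upper that bdd)
    have "norm (distr_of_fun L f u) \<le> (LBINT x:{-L..L}. norm (f x * u x))"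
      unfolding distr_of_fun_def using u by (simp add: set_integral_norm_bound int)
    also have "\<dots> \<le> (LBINT x:{-L..L}. norm (f x) * ?s)"
      by (intro set_integral_mono borel_integrable_atLeastAtMost' continuous_intros f cont u)
        (auto simp: norm_mult intro!: mult_left_mono s)
    also have "\<dots> = (LBINT x:{-L..L}. norm (f x)) * ?s"
      by simp
    finally show ?thesis
      by (simp add: nth_vderiv_def)
  qed
  show ?thesis
    unfolding per_distr_def
  proof (intro CollectI conjI ballI allI impI)
    show "distr_of_fun L f (\<lambda>x. u x + v x) = distr_of_fun L f u + distr_of_fun L f v"
      if "u \<in> per_test L" "v \<in> per_test L" for u v
      using that set_integral_add(2)[OF int int, OF that]
      by (simp add: distr_of_fun_def add_closed distrib_left)
    show "distr_of_fun L f (\<lambda>x. a * u x) = a * distr_of_fun L f u"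
      if "u \<in> per_test L" for u a
      using that by (simp add: distr_of_fun_def mult_closed mult.left_commute)
    show "\<exists>C N. \<forall>u\<in>per_test L. norm (distr_of_fun L f u) \<le>
        C * (\<Sum>j\<le>N. SUP x\<in>{-L..L}. norm (nth_vderiv j u x))"
      using bound by blast
  qed (simp add: distr_of_fun_def)
qed

section \<open>The H^{1/2} norm for even real coefficients\<close>

text \<open>The integers split into the n >= 0 and the -(n + 1), so that the term at 0 is counted
  once only.\<close>

lemma has_sum_even_int:
  fixes g :: "nat \<Rightarrow> real"
  assumes "summable g" and nonneg: "\<And>n. g n \<ge> 0"
  shows "((\<lambda>k::int. g (nat \<bar>k\<bar>)) has_sum (2 * suminf g - g 0)) UNIV"
proof -
  let ?h = "\<lambda>k::int. g (nat \<bar>k\<bar>)"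
  have "(g has_sum suminf g) UNIV"
    by (intro sums_nonneg_imp_has_sum summable_sums assms)
  then have 1: "(?h has_sum suminf g) (range int)"
    by (subst has_sum_reindex) (auto simp: o_def)
  have "(\<lambda>n. g (Suc n)) sums (suminf g - g 0)"
    using assms(1) by (simp add: sums_Suc_iff summable_sums)
  then have "((\<lambda>n. g (Suc n)) has_sum (suminf g - g 0)) UNIV"
    by (intro sums_nonneg_imp_has_sum nonneg)
  then have 2: "(?h has_sum (suminf g - g 0)) (range (\<lambda>n. - int (Suc n)))"
    by (subst has_sum_reindex) (auto simp: o_def inj_on_def nat_add_distrib simp flip: Suc_as_int)
  have disj: "range int \<inter> range (\<lambda>n. - int (Suc n)) = {}"
    by auto
  have "k \<in> range int \<union> range (\<lambda>n. - int (Suc n))" for k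
    by (cases k) auto
  then have "range int \<union> range (\<lambda>n. - int (Suc n)) = UNIV"
    by blast
  with has_sum_Un_disjoint[OF 1 2 disj] show ?thesis
    by simp
qed

text \<open>Deliberately lossy: the weight is at most 1 + n, hence at most its square, which matches
  the square of the bounded quantity.\<close>

lemma H_half_weight_le:
  assumes "(1 + real n) * \<bar>b\<bar> \<le> M"
  shows "sqrt (1 + (real n)\<^sup>2) * b\<^sup>2 \<le> M\<^sup>2"
proof -
  have "sqrt (1 + (real n)\<^sup>2) \<le> 1 + real n"
    by (rule real_le_lsqrt) (auto simp: power2_eq_square algebra_simps)
  also have "\<dots> \<le> (1 + real n)\<^sup>2"
    by (simp add: power2_eq_square algebra_simps)
  finally have "sqrt (1 + (real n)\<^sup>2) * b\<^sup>2 \<le> (1 + real n)\<^sup>2 * b\<^sup>2"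
    by (rule mult_right_mono) auto
  also have "\<dots> = ((1 + real n) * \<bar>b\<bar>)\<^sup>2"
    by (simp add: power_mult_distrib)
  also have "\<dots> \<le> M\<^sup>2"
    using assms by (intro power_mono) auto
  finally show ?thesis .
qed

text \<open>Each term is at most the total sum, so the squares are dominated by a constant multiple
  of the sequence.\<close>

lemma summable_power2:
  fixes M :: "nat \<Rightarrow> real"
  assumes M: "summable M" and nonneg: "\<And>n. M n \<ge> 0"
  shows "summable (\<lambda>n. (M n)\<^sup>2)"
proof (rule summable_comparison_test)
  have "M n \<le> suminf M" for n
    using sum_le_suminf[OF M, of "{n}"] nonneg by simp
  then show "\<exists>N. \<forall>n\<ge>N. norm ((M n)\<^sup>2) \<le> suminf M * M n"
    by (auto simp: power2_eq_square nonneg intro!: mult_right_mono)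
  show "summable (\<lambda>n. suminf M * M n)"
    by (intro summable_mult M)
qed

lemma H_half_summable_even:
  assumes "summable M" and M: "\<And>n. (1 + real n) * \<bar>b n\<bar> \<le> M n"
  shows "summable (\<lambda>n. sqrt (1 + (real n)\<^sup>2) * (b n)\<^sup>2)"
proof (rule summable_comparison_test)
  have "M n \<ge> 0" for n
    using M[of n] by (rule order_trans[rotated]) simp
  then show "summable (\<lambda>n. (M n)\<^sup>2)"
    by (intro summable_power2 assms(1))
  show "\<exists>N. \<forall>n\<ge>N. norm (sqrt (1 + (real n)\<^sup>2) * (b n)\<^sup>2) \<le> (M n)\<^sup>2"
    using H_half_weight_le[OF M] by auto
qed

lemma H_half_even_has_sum:
  assumes T: "\<And>k. fourier_coeff L T k = of_real (b (nat \<bar>k\<bar>))"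
    and b: "summable (\<lambda>n. sqrt (1 + (real n)\<^sup>2) * (b n)\<^sup>2)"
  shows "((\<lambda>k. sqrt (1 + (real_of_int k)\<^sup>2) * (norm (fourier_coeff L T k))\<^sup>2) has_sum
           (2 * (\<Sum>n. sqrt (1 + (real n)\<^sup>2) * (b n)\<^sup>2) - (b 0)\<^sup>2)) UNIV"
  using has_sum_even_int[OF b] by (simp add: T)

text \<open>The common form of both limits in the C^1 condition: coefficientwise convergence plus a
  majorant \<open>M\<close> independent of \<open>d\<close>. After folding the sum over the integers
  to one over the naturals, Tannery's theorem applies with majorant
  \<open>(M n)\<^sup>2\<close>.\<close>

lemma H_half_norm_even_tendsto_0:
  fixes b :: "nat \<Rightarrow> 'a \<Rightarrow> real"
  assumes M: "summable M"
    and ev: "\<forall>\<^sub>F d in F. (\<forall>k. fourier_coeff L (T d) k = of_real (b (nat \<bar>k\<bar>) d)) \<and>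
               (\<forall>n. (1 + real n) * \<bar>b n d\<bar> \<le> M n)"
    and lim: "\<And>n. (b n \<longlongrightarrow> 0) F"
  shows "((\<lambda>d. H_half_norm L (T d)) \<longlongrightarrow> 0) F"
proof (cases "F = bot")
  case False
  define g where "g n d = sqrt (1 + (real n)\<^sup>2) * (b n d)\<^sup>2" for n d
  \<comment> \<open>Nonnegativity of \<open>M\<close> is not assumed; as \<open>F\<close> is
    nontrivial, some \<open>d\<close> exists at which \<open>M n\<close> dominates a nonnegative
    number.\<close>
  obtain d where d: "\<forall>n. (1 + real n) * \<bar>b n d\<bar> \<le> M n"
    using eventually_happens'[OF False ev] by blast
  have "M n \<ge> 0" for n
    using d[rule_format, of n] by (rule order_trans[rotated]) simp
  then have M2: "summable (\<lambda>n. (M n)\<^sup>2)"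
    by (intro summable_power2 M)
  have g0: "(g n \<longlongrightarrow> 0) F" for n
    unfolding g_def[abs_def] by (rule tendsto_eq_intros lim refl | simp)+
  have "\<forall>\<^sub>F (n, d) in at_top \<times>\<^sub>F F. norm (g n d) \<le> (M n)\<^sup>2"
    unfolding eventually_prod_filter
  proof (intro exI conjI allI impI)
    show "\<forall>\<^sub>F n in at_top. True" "\<forall>\<^sub>F d in F. \<forall>n. (1 + real n) * \<bar>b n d\<bar> \<le> M n"
      using ev by (auto elim: eventually_mono)
    show "case (n, d) of (n, d) \<Rightarrow> norm (g n d) \<le> (M n)\<^sup>2"
      if "\<forall>n. (1 + real n) * \<bar>b n d\<bar> \<le> M n" for n d
      using H_half_weight_le[OF that[rule_format]] by (simp add: g_def)
  qed
  from tannerys_theorem[OF g0 this M2 False]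
  have "((\<lambda>d. \<Sum>n. g n d) \<longlongrightarrow> 0) F"
    by simp
  then have "((\<lambda>d. sqrt (2 * L * (2 * (\<Sum>n. g n d) - g 0 d))) \<longlongrightarrow> 0) F"
    by (auto intro!: tendsto_eq_intros g0)
  moreover have "\<forall>\<^sub>F d in F. H_half_norm L (T d) = sqrt (2 * L * (2 * (\<Sum>n. g n d) - g 0 d))"
    using ev
  proof (rule eventually_mono)
    fix d
    assume d: "(\<forall>k. fourier_coeff L (T d) k = of_real (b (nat \<bar>k\<bar>) d)) \<and>
               (\<forall>n. (1 + real n) * \<bar>b n d\<bar> \<le> M n)"
    then have "((\<lambda>k. sqrt (1 + (real_of_int k)\<^sup>2) * (norm (fourier_coeff L (T d) k))\<^sup>2) has_sum
           (2 * (\<Sum>n. sqrt (1 + (real n)\<^sup>2) * (b n d)\<^sup>2) - (b 0 d)\<^sup>2)) UNIV"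
      by (intro H_half_even_has_sum[of L "T d" "\<lambda>n. b n d"] H_half_summable_even[OF M]) auto
    from infsumI[OF this]
    show "H_half_norm L (T d) = sqrt (2 * L * (2 * (\<Sum>n. g n d) - g 0 d))"
      by (simp add: H_half_norm_def g_def)
  qed
  ultimately show ?thesis
    using tendsto_cong by fastforce
qed simp

lemma cos_series_in_H_half_per:
  assumes "L > 0" "summable M" and M: "\<And>n. (1 + real n) * \<bar>b n\<bar> \<le> M n"
  shows "summable (\<lambda>n. \<bar>b n\<bar>)"
    and "distr_of_fun L (\<lambda>x. of_real (cos_series L b x)) \<in> H_half_per L"
proof -
  have "\<bar>b n\<bar> \<le> (1 + real n) * \<bar>b n\<bar>" for n
    by (simp add: algebra_simps)
  then have "\<bar>b n\<bar> \<le> M n" for n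
    using M by (rule order_trans)
  then show b: "summable (\<lambda>n. \<bar>b n\<bar>)"
    by (intro summable_comparison_test[OF _ \<open>summable M\<close>]) auto
  show "distr_of_fun L (\<lambda>x. of_real (cos_series L b x)) \<in> H_half_per L"
    unfolding H_half_per_def
    using H_half_even_has_sum[OF fourier_coeff_cos_series[OF assms(1) b]
        H_half_summable_even[OF \<open>summable M\<close> M]]
    by (auto intro!: distr_of_fun_in_per_distr continuous_intros continuous_on_cos_series b
        dest: has_sum_imp_summable)
qed

section \<open>A criterion for curves of cosine series to be C^1\<close>

lemma H_half_C1_on_cos_series:
  fixes a a' :: "nat \<Rightarrow> real \<Rightarrow> real"
  assumes L: "L > 0" and S: "open S"
    and deriv: "\<And>n c. c \<in> S \<Longrightarrow> (a n has_real_derivative a' n c) (at c)"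
    and cont: "\<And>n. continuous_on S (a' n)"
    and bound: "\<And>c. c \<in> S \<Longrightarrow> \<exists>M. summable M \<and>
      (\<forall>\<^sub>F d in nhds c. \<forall>n. (1 + real n) * \<bar>a n d\<bar> \<le> M n \<and> (1 + real n) * \<bar>a' n d\<bar> \<le> M n)"
  shows "H_half_C1_on L S (\<lambda>c. distr_of_fun L (\<lambda>x. of_real (cos_series L (\<lambda>n. a n c) x)))"
proof -
  define \<gamma> D where "\<gamma> c = distr_of_fun L (\<lambda>x. of_real (cos_series L (\<lambda>n. a n c) x))"
    and "D c = distr_of_fun L (\<lambda>x. of_real (cos_series L (\<lambda>n. a' n c) x))" for c
  have loc: "\<exists>M \<delta>. summable M \<and> \<delta> > 0 \<and> ball c \<delta> \<subseteq> S \<and>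
      (\<forall>d\<in>ball c \<delta>. \<forall>n. (1 + real n) * \<bar>a n d\<bar> \<le> M n \<and> (1 + real n) * \<bar>a' n d\<bar> \<le> M n)"
    if c: "c \<in> S" for c
  proof -
    obtain M where "summable M" and
      "\<forall>\<^sub>F d in nhds c. \<forall>n. (1 + real n) * \<bar>a n d\<bar> \<le> M n \<and> (1 + real n) * \<bar>a' n d\<bar> \<le> M n"
      using bound[OF c] by blast
    from this(2) eventually_nhds_in_open[OF S c]
    have "\<forall>\<^sub>F d in nhds c. d \<in> S \<and>
      (\<forall>n. (1 + real n) * \<bar>a n d\<bar> \<le> M n \<and> (1 + real n) * \<bar>a' n d\<bar> \<le> M n)"
      by eventually_elim auto
    then obtain \<delta> where "\<delta> > 0" "\<forall>d. dist d c < \<delta> \<longrightarrow> d \<in> S \<and>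
      (\<forall>n. (1 + real n) * \<bar>a n d\<bar> \<le> M n \<and> (1 + real n) * \<bar>a' n d\<bar> \<le> M n)"
      unfolding eventually_nhds_metric by blast
    with \<open>summable M\<close> show ?thesis
      by (intro exI[of _ M] exI[of _ \<delta>]) (auto simp: dist_commute)
  qed
  have in_H: "\<gamma> c \<in> H_half_per L" "D c \<in> H_half_per L"
    and fc: "fourier_coeff L (\<gamma> c) k = of_real (a (nat \<bar>k\<bar>) c)"
    and fcD: "fourier_coeff L (D c) k = of_real (a' (nat \<bar>k\<bar>) c)" if c: "c \<in> S" for c k
  proof -
    obtain M where "summable M" and M: "\<And>n. (1 + real n) * \<bar>a n c\<bar> \<le> M n"
      "\<And>n. (1 + real n) * \<bar>a' n c\<bar> \<le> M n"
      using loc[OF c] by (auto simp: ball_def)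
    note * = cos_series_in_H_half_per[OF L \<open>summable M\<close>]
    show "\<gamma> c \<in> H_half_per L" "D c \<in> H_half_per L"
      unfolding \<gamma>_def D_def by (intro * M)+
    show "fourier_coeff L (\<gamma> c) k = of_real (a (nat \<bar>k\<bar>) c)"
      unfolding \<gamma>_def by (intro fourier_coeff_cos_series[OF L] *(1)[of "\<lambda>n. a n c"] M)
    show "fourier_coeff L (D c) k = of_real (a' (nat \<bar>k\<bar>) c)"
      unfolding D_def by (intro fourier_coeff_cos_series[OF L] *(1)[of "\<lambda>n. a' n c"] M)
  qed
  have limits: "((\<lambda>d. H_half_norm L (\<lambda>u. (\<gamma> d u - \<gamma> c u) / of_real (d - c) - D c u)) \<longlongrightarrow> 0) (at c within S)"
    "((\<lambda>d. H_half_norm L (\<lambda>u. D d u - D c u)) \<longlongrightarrow> 0) (at c within S)" if c: "c \<in> S" for c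
  proof -
    obtain M \<delta> where "summable M" and \<delta>: "\<delta> > 0" "ball c \<delta> \<subseteq> S"
      and M: "\<And>d n. d \<in> ball c \<delta> \<Longrightarrow> (1 + real n) * \<bar>a' n d\<bar> \<le> M n"
      using loc[OF c] by meson
    have cball: "c \<in> ball c \<delta>"
      using \<delta> by simp
    have M2: "summable (\<lambda>n. 2 * M n)"
      by (intro summable_mult \<open>summable M\<close>)
    \<comment> \<open>The factor 2 is the triangle inequality: \<open>M n\<close> bounds the
      derivative both at \<open>z\<close> and at the centre \<open>c\<close>.\<close>
    have M_diff: "(1 + real n) * \<bar>a' n z - a' n c\<bar> \<le> 2 * M n" if "z \<in> ball c \<delta>" for z n
    proof -
      have "(1 + real n) * \<bar>a' n z - a' n c\<bar> \<le> (1 + real n) * (\<bar>a' n z\<bar> + \<bar>a' n c\<bar>)"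
        by (intro mult_left_mono) auto
      also have "\<dots> \<le> M n + M n"
        unfolding distrib_left by (intro add_mono M that cball)
      finally show ?thesis
        by simp
    qed
    have near: "\<forall>\<^sub>F d in at c within S. d \<in> ball c \<delta> \<and> d \<noteq> c"
      using \<delta>(1) by (auto simp: eventually_at dist_commute intro!: exI[of _ \<delta>])
    show "((\<lambda>d. H_half_norm L (\<lambda>u. (\<gamma> d u - \<gamma> c u) / of_real (d - c) - D c u)) \<longlongrightarrow> 0) (at c within S)"
    proof (rule H_half_norm_even_tendsto_0[OF M2, where b = "\<lambda>n d. (a n d - a n c) / (d - c) - a' n c"])
      show "((\<lambda>d. (a n d - a n c) / (d - c) - a' n c) \<longlongrightarrow> 0) (at c within S)" for n
        using has_field_derivative_at_within[OF deriv[OF c, of n], of S]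
        unfolding has_field_derivative_iff by (rule LIM_zero)
      from near show "\<forall>\<^sub>F d in at c within S.
          (\<forall>k. fourier_coeff L (\<lambda>u. (\<gamma> d u - \<gamma> c u) / of_real (d - c) - D c u) k =
            of_real ((a (nat \<bar>k\<bar>) d - a (nat \<bar>k\<bar>) c) / (d - c) - a' (nat \<bar>k\<bar>) c)) \<and>
          (\<forall>n. (1 + real n) * \<bar>(a n d - a n c) / (d - c) - a' n c\<bar> \<le> 2 * M n)"
      proof (rule eventually_mono, intro conjI allI)
        fix d k n
        assume d: "d \<in> ball c \<delta> \<and> d \<noteq> c"
        then have "d \<in> S"
          using \<delta> by blast
        \<comment> \<open>Coefficients are evaluations at \<open>per_exp L k\<close>, so they
          commute with pointwise operations on arbitrary functionals.\<close>
        have "fourier_coeff L (\<lambda>u. (\<gamma> d u - \<gamma> c u) / of_real (d - c) - D c u) k =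
            (fourier_coeff L (\<gamma> d) k - fourier_coeff L (\<gamma> c) k) / of_real (d - c) - fourier_coeff L (D c) k"
          by (simp add: fourier_coeff_def diff_divide_distrib algebra_simps)
        then show "fourier_coeff L (\<lambda>u. (\<gamma> d u - \<gamma> c u) / of_real (d - c) - D c u) k =
            of_real ((a (nat \<bar>k\<bar>) d - a (nat \<bar>k\<bar>) c) / (d - c) - a' (nat \<bar>k\<bar>) c)"
          using c \<open>d \<in> S\<close> by (simp add: fc fcD)
        have seg: "closed_segment c d \<subseteq> ball c \<delta>"
          using d cball by (intro closed_segment_subset convex_ball) auto
        \<comment> \<open>The intermediate point depends on \<open>n\<close> and \<open>d\<close>,
          but the bound \<open>M n\<close> holds throughout the ball. The two cases only order the
          endpoints for the mean value theorem.\<close>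
        have "\<exists>z\<in>ball c \<delta>. (a n d - a n c) / (d - c) = a' n z"
        proof (cases "c < d")
          case True
          obtain z where z: "c < z" "z < d" "a n d - a n c = (d - c) * a' n z"
            using MVT2[OF True, of "a n" "a' n"] deriv seg \<delta>(2) True
            by (auto simp: closed_segment_eq_real_ivl subset_eq)
          have "z \<in> closed_segment c d"
            using z by (simp add: closed_segment_eq_real_ivl)
          with seg show ?thesis
            using z by (intro bexI[of _ z]) auto
        next
          case False
          with d have dc: "d < c"
            by simp
          obtain z where z: "d < z" "z < c" "a n c - a n d = (c - d) * a' n z"
            using MVT2[OF dc, of "a n" "a' n"] deriv seg \<delta>(2) dc
            by (auto simp: closed_segment_eq_real_ivl subset_eq)
          have "z \<in> closed_segment c d"
            using z by (simp add: closed_segment_eq_real_ivl)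
          moreover have "(a n d - a n c) / (d - c) = a' n z"
            using z dc by (simp add: field_simps)
          ultimately show ?thesis
            using seg by blast
        qed
        then show "(1 + real n) * \<bar>(a n d - a n c) / (d - c) - a' n c\<bar> \<le> 2 * M n"
          using M_diff by auto
      qed
    qed
    show "((\<lambda>d. H_half_norm L (\<lambda>u. D d u - D c u)) \<longlongrightarrow> 0) (at c within S)"
    proof (rule H_half_norm_even_tendsto_0[OF M2, where b = "\<lambda>n d. a' n d - a' n c"])
      show "((\<lambda>d. a' n d - a' n c) \<longlongrightarrow> 0) (at c within S)" for n
        using cont c by (intro LIM_zero) (simp add: continuous_on_def)
      from near show "\<forall>\<^sub>F d in at c within S.
          (\<forall>k. fourier_coeff L (\<lambda>u. D d u - D c u) k = of_real (a' (nat \<bar>k\<bar>) d - a' (nat \<bar>k\<bar>) c)) \<and>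
          (\<forall>n. (1 + real n) * \<bar>a' n d - a' n c\<bar> \<le> 2 * M n)"
      proof (rule eventually_mono, intro conjI allI)
        fix d k n
        assume d: "d \<in> ball c \<delta> \<and> d \<noteq> c"
        then have "d \<in> S"
          using \<delta> by blast
        have "fourier_coeff L (\<lambda>u. D d u - D c u) k = fourier_coeff L (D d) k - fourier_coeff L (D c) k"
          by (simp add: fourier_coeff_def diff_divide_distrib)
        then show "fourier_coeff L (\<lambda>u. D d u - D c u) k = of_real (a' (nat \<bar>k\<bar>) d - a' (nat \<bar>k\<bar>) c)"
          using c \<open>d \<in> S\<close> by (simp add: fcD)
        show "(1 + real n) * \<bar>a' n d - a' n c\<bar> \<le> 2 * M n"
          using d by (intro M_diff) auto
      qed
    qed
  qed
  have "H_half_C1_on L S \<gamma>"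
    unfolding H_half_C1_on_def using in_H limits by blast
  then show ?thesis
    by (simp add: \<gamma>_def[abs_def])
qed

text \<open>Limits within \<open>S\<close> see the curve only on \<open>S\<close>. This matters
  because the cosine expansion of \<open>phi L c\<close> is established only for c above the
  threshold.\<close>

lemma H_half_C1_on_cong:
  assumes "\<And>c. c \<in> S \<Longrightarrow> \<gamma> c = \<gamma>' c"
  shows "H_half_C1_on L S \<gamma> \<longleftrightarrow> H_half_C1_on L S \<gamma>'"
proof -
  have "((\<lambda>d. H_half_norm L (\<lambda>u. (\<gamma> d u - \<gamma> c u) / of_real (d - c) - T u)) \<longlongrightarrow> 0) (at c within S) \<longleftrightarrow>
      ((\<lambda>d. H_half_norm L (\<lambda>u. (\<gamma>' d u - \<gamma>' c u) / of_real (d - c) - T u)) \<longlongrightarrow> 0) (at c within S)"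
    if "c \<in> S" for c T
    using that by (intro tendsto_cong) (auto simp: eventually_at_filter assms intro!: always_eventually)
  with assms show ?thesis
    unfolding H_half_C1_on_def by auto
qed

section \<open>The Poisson kernel\<close>

text \<open>With z = q e^{i \<theta>}, the series is twice the real part of the geometric series in
  z, minus 1 to correct the weight at n = 0. Its value (1 - q^2) / |1 - z|^2 becomes the hyperbolic
  quotient on dividing both parts by 2q.\<close>

lemma poisson_kernel_cos_sums:
  fixes \<eta> \<theta> :: real
  assumes "\<eta> > 0"
  shows "(\<lambda>n. (if n = 0 then 1 else 2) * exp (- \<eta>) ^ n * cos (real n * \<theta>)) sums
           (sinh \<eta> / (cosh \<eta> - cos \<theta>))"
proof -
  define q where "q = exp (- \<eta>)"
  define z where "z = of_real q * cis \<theta>"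
  have q: "0 < q" "q < 1"
    using assms by (auto simp: q_def)
  have z1: "norm z < 1"
    using q by (simp add: z_def norm_mult)
  then have "z \<noteq> 1"
    by auto
  have "(\<lambda>n. Re (z ^ n)) sums Re (1 / (1 - z))"
    by (intro sums_Re geometric_sums z1)
  then have "(\<lambda>n. 2 * Re (z ^ n) - (if n = 0 then 1 else 0)) sums (2 * Re (1 / (1 - z)) - 1)"
    using sums_diff[OF sums_mult[of _ _ 2] sums_single[of 0 "\<lambda>_. 1::real"]] by blast
  moreover have "2 * Re (z ^ n) - (if n = 0 then 1 else 0) = (if n = 0 then 1 else 2) * q ^ n * cos (real n * \<theta>)" for n
    by (simp add: z_def power_mult_distrib Complex.DeMoivre flip: of_real_power)
  moreover have "2 * Re (1 / (1 - z)) - 1 = sinh \<eta> / (cosh \<eta> - cos \<theta>)"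
  proof -
    have "1 < cosh \<eta>"
      using assms cosh_real_strict_mono[of 0 \<eta>] by simp
    then have pos: "cosh \<eta> - cos \<theta> > 0"
      using cos_le_one[of \<theta>] by linarith
    have e: "exp \<eta> = 1 / q"
      by (simp add: q_def exp_minus divide_inverse)
    have sh: "2 * q * sinh \<eta> = 1 - q\<^sup>2" "2 * q * cosh \<eta> = 1 + q\<^sup>2"
      using q by (simp_all add: sinh_def cosh_def e field_simps power2_eq_square flip: q_def)
    \<comment> \<open>The left side is |1 - z|^2, the denominator of
      \<open>Re (1 / (1 - z))\<close>.\<close>
    have nz: "(1 - q * cos \<theta>)\<^sup>2 + (q * sin \<theta>)\<^sup>2 = 2 * q * (cosh \<eta> - cos \<theta>)"
    proof -
      have "(1 - q * cos \<theta>)\<^sup>2 + (q * sin \<theta>)\<^sup>2 = 1 - 2 * q * cos \<theta> + q\<^sup>2 * ((sin \<theta>)\<^sup>2 + (cos \<theta>)\<^sup>2)"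
        by algebra
      then show ?thesis
        using sh by (simp add: algebra_simps)
    qed
    have re: "Re (1 / (1 - z)) = (1 - q * cos \<theta>) / (2 * q * (cosh \<eta> - cos \<theta>))"
      using nz by (simp add: z_def Re_divide)
    have frac: "2 * (a / b) - 1 = (2 * a - b) / b" if "b \<noteq> 0" for a b :: real
      using that by (simp add: field_simps)
    have "2 * Re (1 / (1 - z)) - 1 = (2 * (1 - q * cos \<theta>) - 2 * q * (cosh \<eta> - cos \<theta>)) / (2 * q * (cosh \<eta> - cos \<theta>))"
      unfolding re by (rule frac) (use pos q in simp)
    also have "\<dots> = (2 * q * sinh \<eta>) / (2 * q * (cosh \<eta> - cos \<theta>))"
      using sh by (simp add: algebra_simps)
    also have "\<dots> = sinh \<eta> / (cosh \<eta> - cos \<theta>)"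
      using q by simp
    finally show ?thesis .
  qed
  ultimately show ?thesis
    by (simp add: q_def)
qed

section \<open>Coefficients in geometric progression\<close>

text \<open>These are the terms of the second derivative of the geometric series, and
  differentiation preserves convergence inside the unit disc.\<close>

lemma summable_quadratic_geometric:
  fixes r :: real
  assumes "0 \<le> r" "r < 1"
  shows "summable (\<lambda>n. (1 + real n) * (2 + real n) * r ^ n)"
proof -
  have 1: "summable (\<lambda>n. diffs (\<lambda>_. 1) n * x ^ n)" if "norm x < 1" for x :: real
    using that by (rule termdiff_converges) simp
  have "summable (\<lambda>n. diffs (diffs (\<lambda>_. 1)) n * r ^ n)"
    by (rule termdiff_converges[OF _ 1]) (use assms in auto)
  then show ?thesis
    by (simp add: diffs_def algebra_simps)
qed

text \<open>One linear factor in the majorant comes from the weight 1 + n, the other from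
  differentiating the n-th power of q.\<close>

lemma H_half_C1_on_cos_series_geometric:
  fixes A q A' q' :: "real \<Rightarrow> real"
  assumes L: "L > 0" and S: "open S"
    and A: "\<And>c. c \<in> S \<Longrightarrow> (A has_real_derivative A' c) (at c)" "continuous_on S A'"
    and q: "\<And>c. c \<in> S \<Longrightarrow> (q has_real_derivative q' c) (at c)" "continuous_on S q'"
    and q1: "\<And>c. c \<in> S \<Longrightarrow> \<bar>q c\<bar> < 1"
  shows "H_half_C1_on L S (\<lambda>c. distr_of_fun L (\<lambda>x. of_real (cos_series L (\<lambda>n. A c * q c ^ n) x)))"
proof (rule H_half_C1_on_cos_series[OF L S])
  define a' where "a' n c = A' c * q c ^ n + A c * (real n * q c ^ (n - 1) * q' c)" for n c
  have contA: "continuous_on S A" and contq: "continuous_on S q"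
    using A(1) q(1) by (blast intro: DERIV_continuous_on has_field_derivative_at_within)+
  show "((\<lambda>c. A c * q c ^ n) has_real_derivative a' n c) (at c)" if "c \<in> S" for n c
    unfolding a'_def by (rule derivative_eq_intros A(1) q(1) that refl | simp)+
  show "continuous_on S (a' n)" for n
    unfolding a'_def by (intro continuous_intros A(2) q(2) contA contq)
  show "\<exists>M. summable M \<and> (\<forall>\<^sub>F d in nhds c. \<forall>n. (1 + real n) * \<bar>A d * q d ^ n\<bar> \<le> M n \<and>
      (1 + real n) * \<bar>a' n d\<bar> \<le> M n)" if c: "c \<in> S" for c
  proof -
    \<comment> \<open>The midpoint of |q(c)| and 1 leaves room for q to vary near c, and it is
      positive even if q(c) = 0, so dividing by \<open>r\<close> is safe.\<close>
    define r where "r = (\<bar>q c\<bar> + 1) / 2"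
    define K where "K = \<bar>A c\<bar> + \<bar>A' c\<bar> + \<bar>q' c\<bar> + 1"
    \<comment> \<open>\<open>K\<close> accounts for the terms with the full power of q, and
      \<open>K * K / r\<close> for the one with exponent n - 1, whose missing factor is restored by
      dividing by \<open>r\<close>.\<close>
    define M where "M n = (K + K * K / r) * ((1 + real n) * (2 + real n) * r ^ n)" for n
    have r: "0 < r" "r < 1" "\<bar>q c\<bar> < r"
      using q1[OF c] by (auto simp: r_def)
    have K: "K > 0" "\<bar>A c\<bar> < K" "\<bar>A' c\<bar> < K" "\<bar>q' c\<bar> < K"
      by (auto simp: K_def)
    have near: "\<forall>\<^sub>F d in nhds c. \<bar>f d\<bar> < B" if "continuous_on S f" "\<bar>f c\<bar> < B" for f :: "real \<Rightarrow> real" and B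
    proof -
      have "isCont f c"
        using that(1) c S by (simp add: continuous_on_eq_continuous_at)
      then have "((\<lambda>d. \<bar>f d\<bar>) \<longlongrightarrow> \<bar>f c\<bar>) (nhds c)"
        by (auto simp: isCont_def tendsto_at_iff_tendsto_nhds intro: tendsto_rabs)
      then show ?thesis
        using that(2) by (rule order_tendstoD)
    qed
    have "summable M"
      unfolding M_def using r by (intro summable_mult summable_quadratic_geometric) auto
    moreover have "\<forall>\<^sub>F d in nhds c. \<forall>n. (1 + real n) * \<bar>A d * q d ^ n\<bar> \<le> M n \<and>
      (1 + real n) * \<bar>a' n d\<bar> \<le> M n"
      using near[OF contA K(2)] near[OF A(2) K(3)] near[OF q(2) K(4)] near[OF contq r(3)]
    proof eventually_elim
      case (elim d)
      show ?case
      proof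
        fix n
        have qn: "\<bar>q d ^ m\<bar> \<le> r ^ m" for m
          unfolding power_abs using elim by (intro power_mono) auto
        have 1: "\<bar>A d * q d ^ n\<bar> \<le> K * r ^ n" "\<bar>A' d * q d ^ n\<bar> \<le> K * r ^ n"
          unfolding abs_mult using elim(1,2) K(1) by (intro mult_mono qn; simp)+
        \<comment> \<open>At n = 0 the exponent \<open>n - 1\<close> is truncated, but the factor
          \<open>real n\<close> vanishes.\<close>
        have 2: "\<bar>A d * (real n * q d ^ (n - 1) * q' d)\<bar> \<le> real n * (K * K / r) * r ^ n"
        proof (cases n)
          case (Suc m)
          have "\<bar>A d * (real n * q d ^ (n - 1) * q' d)\<bar> = real n * (\<bar>A d\<bar> * \<bar>q' d\<bar> * \<bar>q d ^ m\<bar>)"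
            by (simp add: abs_mult Suc)
          also have "\<dots> \<le> real n * (K * K * r ^ m)"
            using elim(1,3) K(1) by (intro mult_left_mono mult_mono qn) simp_all
          also have "\<dots> = real n * (K * K / r) * r ^ n"
            using r by (simp add: Suc)
          finally show ?thesis .
        qed simp
        have KK: "0 < K * K / r" "0 < r ^ n"
          using K r by auto
        have "K * (1 * r ^ n) \<le> (K + K * K / r) * ((2 + real n) * r ^ n)"
          using KK K(1) by (intro mult_mono mult_nonneg_nonneg) simp_all
        then have "\<bar>A d * q d ^ n\<bar> \<le> (K + K * K / r) * ((2 + real n) * r ^ n)"
          using 1(1) by linarith
        moreover have "\<bar>a' n d\<bar> \<le> (K + K * K / r) * ((2 + real n) * r ^ n)"
        proof -
          have "\<bar>a' n d\<bar> \<le> (K * 1 + (K * K / r) * real n) * r ^ n"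
            unfolding a'_def using 1 2 by (simp add: algebra_simps)
          also have "\<dots> \<le> (K * (2 + real n) + (K * K / r) * (2 + real n)) * r ^ n"
            using KK K by (intro mult_right_mono add_mono mult_left_mono) auto
          finally show ?thesis
            by (simp add: algebra_simps)
        qed
        ultimately have "(1 + real n) * \<bar>A d * q d ^ n\<bar> \<le> (1 + real n) * ((K + K * K / r) * ((2 + real n) * r ^ n))"
          "(1 + real n) * \<bar>a' n d\<bar> \<le> (1 + real n) * ((K + K * K / r) * ((2 + real n) * r ^ n))"
          by (auto intro!: mult_left_mono)
        then show "(1 + real n) * \<bar>A d * q d ^ n\<bar> \<le> M n \<and> (1 + real n) * \<bar>a' n d\<bar> \<le> M n"
          by (simp add: M_def mult_ac)
      qed
    qed
    ultimately show ?thesis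
      by blast
  qed
qed

section \<open>The curve of the theorem\<close>

text \<open>Origin of the threshold: multiplied by L - pi > 0, the condition on c reads pi < (c -
  1)(L - pi), that is, c pi < (c - 1) L.\<close>

lemma eta_argument_bounds:
  assumes "L > pi" "c > 1 + pi / (L - pi)"
  shows "c > 1" "0 < c * pi / ((c - 1) * L)" "c * pi / ((c - 1) * L) < 1"
proof -
  show c: "c > 1"
    using assms by (smt (verit) divide_pos_pos pi_gt_zero)
  have "pi < (c - 1) * (L - pi)"
    using assms by (simp add: field_simps)
  then have "c * pi < (c - 1) * L"
    by (simp add: algebra_simps)
  moreover have "L > 0"
    using assms pi_gt_zero by linarith
  ultimately show "0 < c * pi / ((c - 1) * L)" "c * pi / ((c - 1) * L) < 1"
    using c by (auto simp: divide_simps)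
qed

lemma eta_pos:
  assumes "L > pi" "c > 1 + pi / (L - pi)"
  shows "eta L c > 0"
  using eta_argument_bounds[OF assms] by (simp add: eta_def artanh_def)

lemma phi_eq_cos_series:
  assumes "L > pi" "c > 1 + pi / (L - pi)"
  shows "phi L c = cos_series L (\<lambda>n. 2 * c * pi / L * exp (- eta L c) ^ n)"
proof
  fix x
  have "(\<lambda>n. (2 * c * pi / L) * ((if n = 0 then 1 else 2) * exp (- eta L c) ^ n * cos (real n * (pi * x / L))))
      sums phi L c x"
    unfolding phi_def by (intro sums_mult poisson_kernel_cos_sums eta_pos assms)
  then show "phi L c x = cos_series L (\<lambda>n. 2 * c * pi / L * exp (- eta L c) ^ n) x"
    unfolding cos_series_def by (subst sums_unique) (auto simp: mult_ac)
qed

theorem proposition5p1: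
  fixes L :: real
  assumes "L > pi"
  shows "H_half_C1_on L {1 + pi / (L - pi)<..}
           (\<lambda>c. distr_of_fun L (\<lambda>\<xi>. complex_of_real (phi L c \<xi>))) \<and>
         (\<forall>c > 1 + pi / (L - pi). \<forall>\<xi>. phi L c \<xi> > 0)"
proof (intro conjI allI impI)
  define S where "S = {1 + pi / (L - pi)<..}"
  define t where "t c = c * pi / ((c - 1) * L)" for c
  define t' where "t' c = - pi / ((c - 1)\<^sup>2 * L)" for c
  have L: "L > 0"
    using assms pi_gt_zero by linarith
  have c1: "c > 1" and t: "0 < t c" "t c < 1" and eta: "eta L c > 0" if "c \<in> S" for c
    using that eta_argument_bounds[OF assms] eta_pos[OF assms] by (auto simp: S_def t_def)
  \<comment> \<open>Keeps the denominator of the derivative of \<open>artanh\<close> away from 0,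
    which the continuity of the derivative of q needs.\<close>
  have t2: "(t c)\<^sup>2 < 1" if "c \<in> S" for c
    using t[OF that] by (simp add: power_less_one_iff)
  have dt: "(t has_real_derivative t' c) (at c)" if "c \<in> S" for c
  proof -
    have "(t has_real_derivative (pi * ((c - 1) * L) - c * pi * L) / ((c - 1) * L)\<^sup>2) (at c)"
      unfolding t_def using c1[OF that] L
      by (auto intro!: derivative_eq_intros simp: power2_eq_square)
    moreover have "pi * ((c - 1) * L) - c * pi * L = - pi * L"
      by (simp add: algebra_simps)
    ultimately show ?thesis
      using L by (simp add: t'_def power2_eq_square mult.assoc)
  qed
  have deta: "(eta L has_real_derivative t' c / (1 - (t c)\<^sup>2)) (at c)" if "c \<in> S" for c
  proof -
    have "((\<lambda>c. artanh (t c)) has_real_derivative 1 / (1 - (t c)\<^sup>2) * t' c) (at c)"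
      using t[OF that] by (intro DERIV_chain2[OF _ dt[OF that]] artanh_real_has_field_derivative) auto
    then show ?thesis
      by (simp add: eta_def[abs_def] t_def)
  qed
  have cont_eta: "continuous_on S (eta L)" and cont_t: "continuous_on S t"
    by (rule DERIV_continuous_on,
        erule has_field_derivative_at_within[OF deta] has_field_derivative_at_within[OF dt])+
  have "H_half_C1_on L S (\<lambda>c. distr_of_fun L (\<lambda>\<xi>. of_real
      (cos_series L (\<lambda>n. 2 * c * pi / L * exp (- eta L c) ^ n) \<xi>)))"
  proof (rule H_half_C1_on_cos_series_geometric[OF L])
    show "((\<lambda>c. 2 * c * pi / L) has_real_derivative 2 * pi / L) (at c)" for c
      using L by (auto intro!: derivative_eq_intros)
    show "((\<lambda>c. exp (- eta L c)) has_real_derivative - exp (- eta L c) * (t' c / (1 - (t c)\<^sup>2))) (at c)"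
      if "c \<in> S" for c
      by (rule derivative_eq_intros deta that refl | simp)+
    show "continuous_on S (\<lambda>c. - exp (- eta L c) * (t' c / (1 - (t c)\<^sup>2)))"
      unfolding t'_def using t2 c1 L
      by (intro continuous_intros cont_eta cont_t) force+
    show "\<bar>exp (- eta L c)\<bar> < 1" if "c \<in> S" for c
      using eta[OF that] by simp
  qed (auto simp: S_def)
  moreover have "phi L c = cos_series L (\<lambda>n. 2 * c * pi / L * exp (- eta L c) ^ n)" if "c \<in> S" for c
    using that phi_eq_cos_series[OF assms] by (simp add: S_def)
  ultimately show "H_half_C1_on L {1 + pi / (L - pi)<..}
      (\<lambda>c. distr_of_fun L (\<lambda>\<xi>. complex_of_real (phi L c \<xi>)))"
    unfolding S_def[symmetric] by (subst H_half_C1_on_cong) auto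
next
  fix c \<xi> :: real
  assume c: "c > 1 + pi / (L - pi)"
  have "eta L c > 0"
    by (rule eta_pos[OF assms c])
  \<comment> \<open>Positivity of the denominator: cosh exceeds 1 strictly away from 0, while cos
    never does.\<close>
  then have "cosh (eta L c) > 1"
    using cosh_real_strict_mono[of 0 "eta L c"] by simp
  then have "cosh (eta L c) - cos (pi * \<xi> / L) > 0"
    using cos_le_one[of "pi * \<xi> / L"] by linarith
  moreover have "L > 0" "c > 0"
    using assms pi_gt_zero eta_argument_bounds(1)[OF assms c] by linarith+
  ultimately show "phi L c \<xi> > 0"
    using \<open>eta L c > 0\<close> by (simp add: phi_def)
qed

end
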